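(* Let $X$ be a metric space, let $\mu \in \mathcal{P}(X)$, and let $I \colon E \to \mathbb{R}$ be an Onsager--Machlup functional for $\mu$, defined on a nonempty subset $E \subseteq X$ with property $M(\mu, E)$. Then $u \in E$ is a global weak mode of $\mu$ if and only if $u$ is a (global) minimiser of the extended Onsager--Machlup functional $I \colon X \to \overline{\mathbb{R}}$.
   Context: For a metric space $X$, $\mathcal{P}(X)$ is the set of Borel probability measures on $X$, $B_r(x)$ is the open ball of radius $r$ centred at $x$, and $\overline{\mathbb{R}} = \mathbb{R} \cup \{\pm\infty\}$. The support of $\mu \in \mathcal{P}(X)$ is $\operatorname{supp}(\mu) = \{x \in X : \mu(B_r(x)) > 0 \text{ for all } r > 0\}$. Onsager--Machlup (OM) functional: for a nonempty set $E \subseteq \operatorname{supp}(\mu)$, a function $I \colon E \to \mathbb{R}$ is an OM functional for $\mu$ if $\lim_{r \searrow 0} \frac{\mu(B_r(x_1))}{\mu(B_r(x_2))} = \exp(I(x_2) - I(x_1))$ for all $x_1, x_2 \in E$. (The requirement $E \subseteq \operatorname{supp}(\mu)$ is part of the definition.) Property $M(\mu, E)$: there is some $x^\star \in E$ such that for every $x \in X \setminus E$, $\lim_{r \searrow 0} \frac{\mu(B_r(x))}{\mu(B_r(x^\star))} = 0$. In this situation the extended OM functional $I \colon X \to \overline{\mathbb{R}}$ is obtained by setting $I(x) = +\infty$ for $x \in X \setminus E$. Global weak mode: a point $u \in \operatorname{supp}(\mu)$ such that for every $u' \in X$, $\limsup_{r \searrow 0} \frac{\mu(B_r(u'))}{\mu(B_r(u))}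 \leq 1$. *)

theory Defs
  imports "HOL-Probability.Probability"
begin

text \<open>
  The metric space \<open>X\<close> is an arbitrary type of class \<^class>\<open>metric_space\<close>.
  A measure \<open>\<mu>\<close> on it lies in \<open>\<P>(X)\<close> iff \<open>prob_space \<mu>\<close> and \<open>sets \<mu> = sets borel\<close>;
  the definitions below are meant for such \<open>\<mu>\<close>. Limits for \<open>r\<close> decreasing to \<open>0\<close> are taken
  along \<open>at_right 0\<close>.
\<close>

definition msupport :: "'a::metric_space measure \<Rightarrow> 'a set" where
  "msupport \<mu> = {x. \<forall>r>0. measure \<mu> (ball x r) > 0}"

text \<open>
  A function \<open>E \<rightarrow> \<real>\<close> is represented by a total function of which only the values on \<open>E\<close> are used.
\<close>

definition OM_functional :: "'a::metric_space measure \<Rightarrow> 'a set \<Rightarrow> ('a \<Rightarrow> real) \<Rightarrow> bool" where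
  "OM_functional \<mu> E I \<longleftrightarrow>
     E \<noteq> {} \<and> E \<subseteq> msupport \<mu> \<and>
     (\<forall>x\<^sub>1\<in>E. \<forall>x\<^sub>2\<in>E.
        ((\<lambda>r. measure \<mu> (ball x\<^sub>1 r) / measure \<mu> (ball x\<^sub>2 r))
           \<longlongrightarrow> exp (I x\<^sub>2 - I x\<^sub>1)) (at_right 0))"

text \<open>
  The quotient is meaningful only if \<open>xs\<close> lies in the support (otherwise \<open>a / 0 = 0\<close> intervenes);
  this holds whenever \<open>E \<subseteq> msupport \<mu>\<close>, as required by \<open>OM_functional\<close>.
\<close>

definition property_M :: "'a::metric_space measure \<Rightarrow> 'a set \<Rightarrow> bool" where
  "property_M \<mu> E \<longleftrightarrow>
     (\<exists>xs\<in>E. \<forall>x. x \<notin> E \<longrightarrow>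
        ((\<lambda>r. measure \<mu> (ball x r) / measure \<mu> (ball xs r)) \<longlongrightarrow> 0) (at_right 0))"

definition extended_OM :: "'a set \<Rightarrow> ('a \<Rightarrow> real) \<Rightarrow> 'a \<Rightarrow> ereal" where
  "extended_OM E I x = (if x \<in> E then ereal (I x) else \<infinity>)"

text \<open>The quotients are real numbers, but their limit superior may be \<open>\<infinity>\<close>, hence \<^typ>\<open>ereal\<close>.\<close>

definition global_weak_mode :: "'a::metric_space measure \<Rightarrow> 'a \<Rightarrow> bool" where
  "global_weak_mode \<mu> u \<longleftrightarrow>
     u \<in> msupport \<mu> \<and>
     (\<forall>u'. Limsup (at_right 0) (\<lambda>r. ereal (measure \<mu> (ball u' r) / measure \<mu> (ball u r))) \<le> 1)"

definition global_minimiser :: "('a \<Rightarrow> ereal) \<Rightarrow> 'a \<Rightarrow> bool" where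
  "global_minimiser f u \<longleftrightarrow> (\<forall>x. f u \<le> f x)"

end

theory Submission
  imports Defs
begin

text \<open>
  The reason is that, for \<open>u \<in> E\<close>, the small-ball ratio \<open>\<mu>(B\<^sub>r(x)) / \<mu>(B\<^sub>r(u))\<close> does not merely have
  a limit superior but converges for every point \<open>x\<close> of the space: the limit is
  \<open>exp (I u - I x)\<close> for \<open>x \<in> E\<close> by the Onsager--Machlup property, and \<open>0\<close> for \<open>x \<notin> E\<close> by property
  \<open>M\<close>. This is \<open>exp (I u - I x)\<close> for the extended functional, with \<open>exp (- \<infinity>) = 0\<close>. The limit
  superior is therefore this limit, and it is at most \<open>1\<close> exactly when \<open>I u \<le> I x\<close>. Points outside
  \<open>E\<close> constrain neither side of the equivalence, as \<open>0 \<le> 1\<close> and \<open>I u < \<infinity>\<close>.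
\<close>

lemma Limsup_ereal_eq_lim:
  fixes f :: "'b \<Rightarrow> real"
  assumes "(f \<longlongrightarrow> l) F" and "F \<noteq> bot"
  shows "Limsup F (\<lambda>r. ereal (f r)) = ereal l"
  using assms by (intro lim_imp_Limsup) auto

text \<open>
  Property \<open>M\<close> compares outside points with a single reference point of \<open>E\<close>. The Onsager--Machlup
  property makes the ball masses around any two points of \<open>E\<close> comparable up to a finite constant, so
  every point of \<open>E\<close> serves as reference.
\<close>

lemma ball_ratio_tendsto_0_outside:
  assumes OM: "OM_functional \<mu> E I" and M: "property_M \<mu> E"
    and u: "u \<in> E" and x: "x \<notin> E"
  shows "((\<lambda>r. measure \<mu> (ball x r) / measure \<mu> (ball u r)) \<longlongrightarrow> 0) (at_right 0)"
proof -
  obtain xs where xs: "xs \<in> E"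
    and lim: "((\<lambda>r. measure \<mu> (ball x r) / measure \<mu> (ball xs r)) \<longlongrightarrow> 0) (at_right 0)"
    using M x unfolding property_M_def by blast
  have pos: "measure \<mu> (ball xs r) > 0" if "r > 0" for r
    using OM xs that unfolding OM_functional_def msupport_def by blast
  have "((\<lambda>r. measure \<mu> (ball xs r) / measure \<mu> (ball u r)) \<longlongrightarrow> exp (I u - I xs)) (at_right 0)"
    using OM xs u unfolding OM_functional_def by blast
  from tendsto_mult[OF lim this]
  have "((\<lambda>r. (measure \<mu> (ball x r) / measure \<mu> (ball xs r))
            * (measure \<mu> (ball xs r) / measure \<mu> (ball u r))) \<longlongrightarrow> 0) (at_right 0)"
    by simp
  moreover
  \<comment> \<open>The mass around the reference point cancels because that point lies in the support.\<close>
  have "\<forall>\<^sub>F r in at_right 0.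
      (measure \<mu> (ball x r) / measure \<mu> (ball xs r))
        * (measure \<mu> (ball xs r) / measure \<mu> (ball u r))
      = measure \<mu> (ball x r) / measure \<mu> (ball u r)"
    using eventually_at_right_less[of "0::real"]
    by eventually_elim (use pos in force)
  ultimately show ?thesis
    by (rule Lim_transform_eventually)
qed

lemma Limsup_ball_ratio:
  assumes "OM_functional \<mu> E I" and "property_M \<mu> E" and "u \<in> E"
  shows "Limsup (at_right 0) (\<lambda>r. ereal (measure \<mu> (ball x r) / measure \<mu> (ball u r)))
       = ereal (if x \<in> E then exp (I u - I x) else 0)"
proof (rule Limsup_ereal_eq_lim)
  show "((\<lambda>r. measure \<mu> (ball x r) / measure \<mu> (ball u r))
          \<longlongrightarrow> (if x \<in> E then exp (I u - I x) else 0)) (at_right 0)"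
    using assms ball_ratio_tendsto_0_outside[OF assms]
    by (auto simp: OM_functional_def)
qed simp

theorem proposition4p1:
  fixes \<mu> :: "'a::metric_space measure" and E :: "'a set" and I :: "'a \<Rightarrow> real" and u :: 'a
  assumes "prob_space \<mu>" and "sets \<mu> = sets borel"
    and "OM_functional \<mu> E I"
    and "property_M \<mu> E"
    and "u \<in> E"
  shows "global_weak_mode \<mu> u \<longleftrightarrow> global_minimiser (extended_OM E I) u"
proof -
  have "u \<in> msupport \<mu>"
    using assms(3,5) unfolding OM_functional_def by blast
  then have "global_weak_mode \<mu> u \<longleftrightarrow> (\<forall>x\<in>E. I u \<le> I x)"
    unfolding global_weak_mode_def Limsup_ball_ratio[OF assms(3-5)]
    by auto
  also have "\<dots> \<longleftrightarrow> global_minimiser (extended_OM E I) u"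
    using \<open>u \<in> E\<close> by (auto simp: global_minimiser_def extended_OM_def)
  finally show ?thesis .
qed

end
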